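(* Let $\tau=\tau(n,m)$ be a nowhere vanishing function on $\mathbb{Z}^2$ (with values in a field), and write $\tau_{i,j}=\tau(n+i,m+j)$, $\tau=\tau_{0,0}$. Define the row vectors $$V=\big(\tau_{0,1}\tau\tau_{0,-1},\ \tau_{1,0}\tau\tau_{-1,0},\ \tau_{1,1}\tau\tau_{-1,-1},\ \tau_{1,0}\tau_{0,-1}\tau_{-1,1}+\tau_{0,1}\tau_{-1,0}\tau_{1,-1}\big),\qquad U=(X_3,X_2,X_4),$$ with $$X_2=\frac{\tau_{0,2}}{\tau_{0,1}\tau\tau_{-1,0}\tau_{1,1}}-\frac{\tau_{0,-2}}{\tau\tau_{0,-1}\tau_{1,0}\tau_{-1,-1}},\quad X_3=\frac{\tau_{2,0}}{\tau\tau_{0,-1}\tau_{1,0}\tau_{1,1}}-\frac{\tau_{-2,0}}{\tau_{0,1}\tau\tau_{-1,-1}\tau_{-1,0}},\quad X_4=\frac{1}{\tau_{0,-1}\tau_{-1,0}\tau_{1,1}}-\frac{1}{\tau_{0,1}\tau_{1,0}\tau_{-1,-1}},$$ and the $4\times 3$ matrices $$P=\begin{pmatrix} \frac{\tau_{-1,1}\tau_{1,0}}{\tau\tau_{0,1}}+\frac{\tau_{-2,1}\tau}{\tau_{-1,0}\tau_{-1,1}} & 0 & 0\\[2mm] \frac{\tau_{1,0}\tau_{-2,0}}{\tau_{0,1}\tau_{-1,-1}} & \frac{\tau\tau_{-1,2}}{\tau_{0,1}\tau_{-1,1}} & \frac{\tau_{-1,0}\tau}{\tau_{0,1}\tau_{-1,-1}}\\[2mm]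 \frac{\tau_{-2,-1}\tau_{1,0}}{\tau_{-1,-1}\tau} & -\frac{\tau_{-1,-1}\tau_{0,2}}{\tau_{0,1}\tau_{-1,0}} & -\frac{\tau_{-1,-1}\tau}{\tau_{0,-1}\tau_{-1,0}}\\[2mm] \frac{\tau_{1,0}\tau_{-2,1}}{\tau_{-1,0}\tau_{0,1}}+\frac{\tau_{0,-1}\tau_{-2,0}\tau_{1,0}\tau_{-1,1}}{\tau_{0,1}\tau\tau_{-1,-1}\tau_{-1,0}} & \frac{\tau_{0,-1}\tau_{-1,2}}{\tau_{0,1}\tau_{-1,0}} & \frac{\tau_{0,-1}\tau_{-1,1}}{\tau_{0,1}\tau_{-1,-1}} \end{pmatrix},$$ $$Q=\begin{pmatrix} \frac{\tau_{-2,0}\tau_{0,-1}}{\tau_{-1,-1}\tau_{-1,0}} & \frac{\tau_{0,1}\tau_{0,-2}}{\tau_{1,0}\tau_{-1,-1}} & \frac{\tau\tau_{0,-1}}{\tau_{1,0}\tau_{-1,-1}}\\[2mm] 0 & \frac{\tau_{0,-1}\tau_{-1,1}}{\tau\tau_{-1,0}}+\frac{\tau_{-1,0}\tau_{0,-2}}{\tau_{0,-1}\tau_{-1,-1}} & 0\\[2mm] -\frac{\tau_{-2,-1}\tau_{1,0}}{\tau_{-1,-1}\tau} & \frac{\tau_{1,1}\tau_{0,-2}}{\tau_{0,-1}\tau_{1,0}} & -\frac{\tau_{0,-1}\tau_{1,0}}{\tau_{1,-1}\tau}\\[2mm] \frac{\tau_{-2,0}\tau_{1,-1}}{\tau\tau_{-1,-1}}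 & \frac{\tau_{0,-2}\tau_{-1,1}}{\tau\tau_{-1,-1}}+\frac{\tau_{0,1}\tau_{0,-2}\tau_{-1,0}\tau_{1,-1}}{\tau\tau_{0,-1}\tau_{1,0}\tau_{-1,-1}} & \frac{\tau_{-1,0}\tau_{1,-1}}{\tau_{1,0}\tau_{-1,-1}} \end{pmatrix}.$$ Then, identically in $\tau$, $$\widetilde{P}-P+\widehat{Q}-Q=V^{T}U .$$ Hence, for constants $A,B,C,D$ and $S=(A,B,C,D)$, if $\tau$ satisfies the trilinear Boussinesq equation $SV^T=0$, i.e. $$\big(A\tau_{0,1}\tau_{0,-1}+B\tau_{1,0}\tau_{-1,0}+C\tau_{1,1}\tau_{-1,-1}\big)\tau+D\big(\tau_{-1,1}\tau_{1,0}\tau_{0,-1}+\tau_{1,-1}\tau_{0,1}\tau_{-1,0}\big)=0,$$ then $S\widetilde{P}-SP+S\widehat{Q}-SQ=0$ (three conservation laws). Likewise, for constants $x,y,z$ and $Y=(x,y,z)$, if $\tau$ satisfies the quadrilinear dual equation $$x(\tau_{0,1}\tau_{-1,0}\tau_{-1,-1}\tau_{2,0}-\tau_{0,-1}\tau_{1,0}\tau_{1,1}\tau_{-2,0})+y(\tau_{0,-1}\tau_{1,0}\tau_{-1,-1}\tau_{0,2}-\tau_{1,1}\tau_{0,1}\tau_{-1,0}\tau_{0,-2})+z(\tau\tau_{1,0}\tau_{0,1}\tau_{-1,-1}-\tau\tau_{0,-1}\tau_{1,1}\tau_{-1,0})=0$$ (which is equivalent to $UY^T=0$), then $\widetilde{P}Y^T-PY^T+\widehat{Q}Y^T-QY^T=0$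 (four conservation laws).
   Context: $\widetilde{\phantom{a}}$ and $\widehat{\phantom{a}}$ denote the lattice shifts $n\mapsto n+1$ and $m\mapsto m+1$ respectively, applied entrywise to matrices whose entries are expressions in shifts of $\tau$ (so $\tau_{i,j}$ becomes $\tau_{i+1,j}$ under $\widetilde{\phantom{a}}$ and $\tau_{i,j+1}$ under $\widehat{\phantom{a}}$). $^T$ denotes transpose. *)

theory Defs
  imports "HOL-Analysis.Analysis"
begin

text \<open>
  An \<open>r \<times> c\<close> matrix over \<open>'a\<close> has type \<open>'a ^ c ^ r\<close>, so that a row vector with \<open>k\<close> entries
  has type \<open>'a ^ k ^ 1\<close>. A quantity built from shifts of \<open>\<tau>\<close> is a function of the lattice
  point \<open>(n, m)\<close>; the local function \<open>t i j\<close> below is the value of \<open>\<tau>\<close> at \<open>(n + i, m + j)\<close>.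
\<close>

definition tilde_shift :: "(int \<Rightarrow> int \<Rightarrow> 'b) \<Rightarrow> int \<Rightarrow> int \<Rightarrow> 'b" where
  "tilde_shift F = (\<lambda>n m. F (n + 1) m)"

definition hat_shift :: "(int \<Rightarrow> int \<Rightarrow> 'b) \<Rightarrow> int \<Rightarrow> int \<Rightarrow> 'b" where
  "hat_shift F = (\<lambda>n m. F n (m + 1))"

definition V_row :: "(int \<Rightarrow> int \<Rightarrow> 'a::field) \<Rightarrow> int \<Rightarrow> int \<Rightarrow> 'a ^ 4 ^ 1" where
  "V_row \<tau> n m = (let t = (\<lambda>i j. \<tau> (n + i) (m + j)) in
     rowvector (vector
       [t 0 1 * t 0 0 * t 0 (-1),
        t 1 0 * t 0 0 * t (-1) 0,
        t 1 1 * t 0 0 * t (-1) (-1),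
        t 1 0 * t 0 (-1) * t (-1) 1 + t 0 1 * t (-1) 0 * t 1 (-1)]))"

definition X2 :: "(int \<Rightarrow> int \<Rightarrow> 'a::field) \<Rightarrow> int \<Rightarrow> int \<Rightarrow> 'a" where
  "X2 \<tau> n m = (let t = (\<lambda>i j. \<tau> (n + i) (m + j)) in
     t 0 2 / (t 0 1 * t 0 0 * t (-1) 0 * t 1 1)
     - t 0 (-2) / (t 0 0 * t 0 (-1) * t 1 0 * t (-1) (-1)))"

definition X3 :: "(int \<Rightarrow> int \<Rightarrow> 'a::field) \<Rightarrow> int \<Rightarrow> int \<Rightarrow> 'a" where
  "X3 \<tau> n m = (let t = (\<lambda>i j. \<tau> (n + i) (m + j)) in
     t 2 0 / (t 0 0 * t 0 (-1) * t 1 0 * t 1 1)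
     - t (-2) 0 / (t 0 1 * t 0 0 * t (-1) (-1) * t (-1) 0))"

definition X4 :: "(int \<Rightarrow> int \<Rightarrow> 'a::field) \<Rightarrow> int \<Rightarrow> int \<Rightarrow> 'a" where
  "X4 \<tau> n m = (let t = (\<lambda>i j. \<tau> (n + i) (m + j)) in
     1 / (t 0 (-1) * t (-1) 0 * t 1 1)
     - 1 / (t 0 1 * t 1 0 * t (-1) (-1)))"

definition U_row :: "(int \<Rightarrow> int \<Rightarrow> 'a::field) \<Rightarrow> int \<Rightarrow> int \<Rightarrow> 'a ^ 3 ^ 1" where
  "U_row \<tau> n m = rowvector (vector [X3 \<tau> n m, X2 \<tau> n m, X4 \<tau> n m])"

definition P_mat :: "(int \<Rightarrow> int \<Rightarrow> 'a::field) \<Rightarrow> int \<Rightarrow> int \<Rightarrow> 'a ^ 3 ^ 4" where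
  "P_mat \<tau> n m = (let t = (\<lambda>i j. \<tau> (n + i) (m + j)) in
     vector
       [vector
          [t (-1) 1 * t 1 0 / (t 0 0 * t 0 1)
             + t (-2) 1 * t 0 0 / (t (-1) 0 * t (-1) 1),
           0,
           0],
        vector
          [t 1 0 * t (-2) 0 / (t 0 1 * t (-1) (-1)),
           t 0 0 * t (-1) 2 / (t 0 1 * t (-1) 1),
           t (-1) 0 * t 0 0 / (t 0 1 * t (-1) (-1))],
        vector
          [t (-2) (-1) * t 1 0 / (t (-1) (-1) * t 0 0),
           - (t (-1) (-1) * t 0 2 / (t 0 1 * t (-1) 0)),
           - (t (-1) (-1) * t 0 0 / (t 0 (-1) * t (-1) 0))],
        vector
          [t 1 0 * t (-2) 1 / (t (-1) 0 * t 0 1)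
             + t 0 (-1) * t (-2) 0 * t 1 0 * t (-1) 1
                 / (t 0 1 * t 0 0 * t (-1) (-1) * t (-1) 0),
           t 0 (-1) * t (-1) 2 / (t 0 1 * t (-1) 0),
           t 0 (-1) * t (-1) 1 / (t 0 1 * t (-1) (-1))]])"

definition Q_mat :: "(int \<Rightarrow> int \<Rightarrow> 'a::field) \<Rightarrow> int \<Rightarrow> int \<Rightarrow> 'a ^ 3 ^ 4" where
  "Q_mat \<tau> n m = (let t = (\<lambda>i j. \<tau> (n + i) (m + j)) in
     vector
       [vector
          [t (-2) 0 * t 0 (-1) / (t (-1) (-1) * t (-1) 0),
           t 0 1 * t 0 (-2) / (t 1 0 * t (-1) (-1)),
           t 0 0 * t 0 (-1) / (t 1 0 * t (-1) (-1))],
        vector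
          [0,
           t 0 (-1) * t (-1) 1 / (t 0 0 * t (-1) 0)
             + t (-1) 0 * t 0 (-2) / (t 0 (-1) * t (-1) (-1)),
           0],
        vector
          [- (t (-2) (-1) * t 1 0 / (t (-1) (-1) * t 0 0)),
           t 1 1 * t 0 (-2) / (t 0 (-1) * t 1 0),
           - (t 0 (-1) * t 1 0 / (t 1 (-1) * t 0 0))],
        vector
          [t (-2) 0 * t 1 (-1) / (t 0 0 * t (-1) (-1)),
           t 0 (-2) * t (-1) 1 / (t 0 0 * t (-1) (-1))
             + t 0 1 * t 0 (-2) * t (-1) 0 * t 1 (-1)
                 / (t 0 0 * t 0 (-1) * t 1 0 * t (-1) (-1)),
           t (-1) 0 * t 1 (-1) / (t 1 0 * t (-1) (-1))]])"

definition trilinear_expr ::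
    "'a \<Rightarrow> 'a \<Rightarrow> 'a \<Rightarrow> 'a \<Rightarrow> (int \<Rightarrow> int \<Rightarrow> 'a::field) \<Rightarrow> int \<Rightarrow> int \<Rightarrow> 'a" where
  "trilinear_expr A B C D \<tau> n m = (let t = (\<lambda>i j. \<tau> (n + i) (m + j)) in
     (A * t 0 1 * t 0 (-1) + B * t 1 0 * t (-1) 0 + C * t 1 1 * t (-1) (-1)) * t 0 0
     + D * (t (-1) 1 * t 1 0 * t 0 (-1) + t 1 (-1) * t 0 1 * t (-1) 0))"

definition trilinear_Boussinesq ::
    "'a \<Rightarrow> 'a \<Rightarrow> 'a \<Rightarrow> 'a \<Rightarrow> (int \<Rightarrow> int \<Rightarrow> 'a::field) \<Rightarrow> bool" where
  "trilinear_Boussinesq A B C D \<tau> \<longleftrightarrow> (\<forall>n m. trilinear_expr A B C D \<tau> n m = 0)"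

definition dual_expr ::
    "'a \<Rightarrow> 'a \<Rightarrow> 'a \<Rightarrow> (int \<Rightarrow> int \<Rightarrow> 'a::field) \<Rightarrow> int \<Rightarrow> int \<Rightarrow> 'a" where
  "dual_expr x y z \<tau> n m = (let t = (\<lambda>i j. \<tau> (n + i) (m + j)) in
     x * (t 0 1 * t (-1) 0 * t (-1) (-1) * t 2 0 - t 0 (-1) * t 1 0 * t 1 1 * t (-2) 0)
     + y * (t 0 (-1) * t 1 0 * t (-1) (-1) * t 0 2 - t 1 1 * t 0 1 * t (-1) 0 * t 0 (-2))
     + z * (t 0 0 * t 1 0 * t 0 1 * t (-1) (-1) - t 0 0 * t 0 (-1) * t 1 1 * t (-1) 0))"

definition quadrilinear_dual ::
    "'a \<Rightarrow> 'a \<Rightarrow> 'a \<Rightarrow> (int \<Rightarrow> int \<Rightarrow> 'a::field) \<Rightarrow> bool" where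
  "quadrilinear_dual x y z \<tau> \<longleftrightarrow> (\<forall>n m. dual_expr x y z \<tau> n m = 0)"

end

theory Submission
  imports Defs
begin

lemma vector_4:
  "(vector [x, y, z, w] :: 'a::zero ^ 4) $ 1 = x"
  "(vector [x, y, z, w] :: 'a::zero ^ 4) $ 2 = y"
  "(vector [x, y, z, w] :: 'a::zero ^ 4) $ 3 = z"
  "(vector [x, y, z, w] :: 'a::zero ^ 4) $ 4 = w"
  unfolding vector_def by simp_all

lemma matrix_diff_ldistrib:
  fixes A :: "'a::ring_1 ^ 'n ^ 'm"
  shows "A ** (B - C) = A ** B - A ** C"
  by (simp add: vec_eq_iff matrix_matrix_mult_def right_diff_distrib sum_subtractf)

lemma matrix_add_rdistrib:
  fixes A :: "'a::semiring_1 ^ 'n ^ 'm"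
  shows "(A + B) ** C = A ** C + B ** C"
  by (simp add: vec_eq_iff matrix_matrix_mult_def distrib_right sum.distrib)

lemma matrix_diff_rdistrib:
  fixes A :: "'a::ring_1 ^ 'n ^ 'm"
  shows "(A - B) ** C = A ** C - B ** C"
  by (simp add: vec_eq_iff matrix_matrix_mult_def left_diff_distrib sum_subtractf)

text \<open>
  Translating \<open>\<tau>\<close> reduces the matrix identity to the origin, where all lattice indices are
  literals and arithmetic identifies equal shifts of \<open>\<tau>\<close>.
\<close>

lemma P_mat_translate: "P_mat \<tau> (n + a) (m + b) = P_mat (\<lambda>i j. \<tau> (n + i) (m + j)) a b"
  by (simp add: P_mat_def add.assoc)

lemma Q_mat_translate: "Q_mat \<tau> (n + a) (m + b) = Q_mat (\<lambda>i j. \<tau> (n + i) (m + j)) a b"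
  by (simp add: Q_mat_def add.assoc)

lemma V_row_translate: "V_row \<tau> (n + a) (m + b) = V_row (\<lambda>i j. \<tau> (n + i) (m + j)) a b"
  by (simp add: V_row_def add.assoc)

lemma U_row_translate: "U_row \<tau> (n + a) (m + b) = U_row (\<lambda>i j. \<tau> (n + i) (m + j)) a b"
  by (simp add: U_row_def X2_def X3_def X4_def add.assoc)

text \<open>The right side is an outer product, so the claim splits into twelve scalar identities
  between rational functions of finitely many values of \<open>\<tau>\<close>. Each becomes a
  polynomial identity once denominators are cleared; declaring the nonvanishing assumption as
  \<open>[simp]\<close> discharges the side conditions of \<open>field_simps\<close>.\<close>

lemma matrix_identity_at_origin:
  fixes \<tau> :: "int \<Rightarrow> int \<Rightarrow> 'a::field"
  assumes [simp]: "\<And>n m. \<tau> n m \<noteq> 0"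
  shows "P_mat \<tau> 1 0 - P_mat \<tau> 0 0 + Q_mat \<tau> 0 1 - Q_mat \<tau> 0 0
         = transpose (V_row \<tau> 0 0) ** U_row \<tau> 0 0"
  unfolding vec_eq_iff forall_4 forall_3
  \<comment> \<open>The inner dimension is 1, so \<open>sum_1\<close> leaves one product per entry.
    Only unfolding happens here; indices such as \<open>1 + (-1)\<close> are evaluated by the second
    call, which makes equal shifts of \<open>\<tau>\<close> syntactically equal.\<close>
  by (simp only: matrix_matrix_mult_def transpose_def rowvector_def vec_lambda_beta sum_1
      V_row_def U_row_def P_mat_def Q_mat_def X2_def X3_def X4_def Let_def vector_4 vector_3
      vector_minus_component vector_add_component)
    (simp add: field_simps)

lemma matrix_identity:
  fixes \<tau> :: "int \<Rightarrow> int \<Rightarrow> 'a::field"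
  assumes "\<And>n m. \<tau> n m \<noteq> 0"
  shows "tilde_shift (P_mat \<tau>) n m - P_mat \<tau> n m + hat_shift (Q_mat \<tau>) n m - Q_mat \<tau> n m
         = transpose (V_row \<tau> n m) ** U_row \<tau> n m"
  \<comment> \<open>The translate of \<open>\<tau>\<close> that moves \<open>(n, m)\<close> to the
    origin is again nowhere zero; the flipped translation rules turn the result back into one about
    \<open>\<tau>\<close>.\<close>
  using matrix_identity_at_origin[of "\<lambda>i j. \<tau> (n + i) (m + j)"] assms
  by (simp add: tilde_shift_def hat_shift_def
      flip: P_mat_translate Q_mat_translate V_row_translate U_row_translate)

lemma V_row_mult_eq_0_iff:
  fixes \<tau> :: "int \<Rightarrow> int \<Rightarrow> 'a::field"
  shows "rowvector (vector [A, B, C, D] :: 'a ^ 4) ** transpose (V_row \<tau> n m) = (0 :: 'a ^ 1 ^ 1)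
         \<longleftrightarrow> trilinear_expr A B C D \<tau> n m = 0"
  by (simp add: vec_eq_iff matrix_matrix_mult_def transpose_def rowvector_def sum_4 vector_4
      V_row_def trilinear_expr_def Let_def algebra_simps)

text \<open>The seven-fold product is the common denominator of \<open>X2\<close>, \<open>X3\<close>
  and \<open>X4\<close>. The value \<open>\<tau> n m\<close> does not occur in the denominators of
  \<open>X4\<close>, so it survives as a factor in the \<open>z\<close> term of the dual
  equation.\<close>

lemma dual_expr_eq:
  fixes \<tau> :: "int \<Rightarrow> int \<Rightarrow> 'a::field"
  assumes [simp]: "\<And>n m. \<tau> n m \<noteq> 0"
  shows "dual_expr x y z \<tau> n m
         = (X3 \<tau> n m * x + X2 \<tau> n m * y + X4 \<tau> n m * z)
           * (\<tau> n m * \<tau> n (m + 1) * \<tau> n (m - 1) * \<tau> (n + 1) m * \<tau> (n - 1) m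
              * \<tau> (n + 1) (m + 1) * \<tau> (n - 1) (m - 1))"
  by (simp add: dual_expr_def X2_def X3_def X4_def Let_def field_simps)

text \<open>The factor relating the two sides in \<open>dual_expr_eq\<close> is a product of nonzero
  values, so one vanishes exactly when the other does.\<close>

lemma U_row_mult_eq_0_iff:
  fixes \<tau> :: "int \<Rightarrow> int \<Rightarrow> 'a::field"
  assumes "\<And>n m. \<tau> n m \<noteq> 0"
  shows "U_row \<tau> n m ** transpose (rowvector (vector [x, y, z] :: 'a ^ 3)) = (0 :: 'a ^ 1 ^ 1)
         \<longleftrightarrow> dual_expr x y z \<tau> n m = 0"
  using assms
  by (simp add: dual_expr_eq vec_eq_iff matrix_matrix_mult_def transpose_def rowvector_def sum_3
      U_row_def)

theorem mainTheorem2: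
  fixes \<tau> :: "int \<Rightarrow> int \<Rightarrow> 'a::field"
  assumes nonvanishing: "\<forall>n m. \<tau> n m \<noteq> 0"
  shows
    "(\<forall>n m. tilde_shift (P_mat \<tau>) n m - P_mat \<tau> n m + hat_shift (Q_mat \<tau>) n m - Q_mat \<tau> n m
              = transpose (V_row \<tau> n m) ** U_row \<tau> n m)
     \<and> (\<forall>A B C D. \<forall>S :: 'a ^ 4 ^ 1. S = rowvector (vector [A, B, C, D]) \<longrightarrow>
          (\<forall>n m. S ** transpose (V_row \<tau> n m) = 0 \<longleftrightarrow> trilinear_expr A B C D \<tau> n m = 0)
          \<and> (trilinear_Boussinesq A B C D \<tau> \<longrightarrow>
              (\<forall>n m. S ** tilde_shift (P_mat \<tau>) n m - S ** P_mat \<tau> n m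
                      + S ** hat_shift (Q_mat \<tau>) n m - S ** Q_mat \<tau> n m = 0)))
     \<and> (\<forall>x y z. \<forall>Y :: 'a ^ 3 ^ 1. Y = rowvector (vector [x, y, z]) \<longrightarrow>
          (\<forall>n m. U_row \<tau> n m ** transpose Y = 0 \<longleftrightarrow> dual_expr x y z \<tau> n m = 0)
          \<and> (quadrilinear_dual x y z \<tau> \<longrightarrow>
              (\<forall>n m. tilde_shift (P_mat \<tau>) n m ** transpose Y - P_mat \<tau> n m ** transpose Y
                      + hat_shift (Q_mat \<tau>) n m ** transpose Y - Q_mat \<tau> n m ** transpose Y = 0)))"
proof (intro conjI allI impI)
  fix n m
  show "tilde_shift (P_mat \<tau>) n m - P_mat \<tau> n m + hat_shift (Q_mat \<tau>) n m - Q_mat \<tau> n m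
        = transpose (V_row \<tau> n m) ** U_row \<tau> n m"
    using nonvanishing by (simp add: matrix_identity)
next
  fix A B C D and S :: "'a ^ 4 ^ 1" and n m
  assume S: "S = rowvector (vector [A, B, C, D])"
  show "S ** transpose (V_row \<tau> n m) = 0 \<longleftrightarrow> trilinear_expr A B C D \<tau> n m = 0"
    unfolding S by (rule V_row_mult_eq_0_iff)
next
  fix A B C D and S :: "'a ^ 4 ^ 1" and n m
  assume S: "S = rowvector (vector [A, B, C, D])" and "trilinear_Boussinesq A B C D \<tau>"
  then have "S ** transpose (V_row \<tau> n m) = 0"
    unfolding S by (simp add: V_row_mult_eq_0_iff trilinear_Boussinesq_def)
  \<comment> \<open>By the matrix identity this is \<open>S\<close> times an outer product;
    \<open>matrix_mul_assoc\<close> regroups it so that \<open>S\<close> meets the transposed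
    \<open>V_row\<close> first, and that product is zero.\<close>
  then have "S ** (tilde_shift (P_mat \<tau>) n m - P_mat \<tau> n m + hat_shift (Q_mat \<tau>) n m
                   - Q_mat \<tau> n m) = 0"
    using nonvanishing by (simp add: matrix_identity matrix_mul_assoc)
  then show "S ** tilde_shift (P_mat \<tau>) n m - S ** P_mat \<tau> n m
             + S ** hat_shift (Q_mat \<tau>) n m - S ** Q_mat \<tau> n m = 0"
    by (simp add: matrix_add_ldistrib matrix_diff_ldistrib)
next
  fix x y z and Y :: "'a ^ 3 ^ 1" and n m
  assume Y: "Y = rowvector (vector [x, y, z])"
  show "U_row \<tau> n m ** transpose Y = 0 \<longleftrightarrow> dual_expr x y z \<tau> n m = 0"
    unfolding Y using nonvanishing by (simp add: U_row_mult_eq_0_iff)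
next
  fix x y z and Y :: "'a ^ 3 ^ 1" and n m
  assume Y: "Y = rowvector (vector [x, y, z])" and "quadrilinear_dual x y z \<tau>"
  then have "U_row \<tau> n m ** transpose Y = 0"
    unfolding Y using nonvanishing by (simp add: U_row_mult_eq_0_iff quadrilinear_dual_def)
  \<comment> \<open>Multiplication is now from the right, so associativity is used in the reverse
    direction to bring \<open>U_row\<close> and \<open>transpose Y\<close> together.\<close>
  then have "(tilde_shift (P_mat \<tau>) n m - P_mat \<tau> n m + hat_shift (Q_mat \<tau>) n m
              - Q_mat \<tau> n m) ** transpose Y = 0"
    using nonvanishing by (simp add: matrix_identity flip: matrix_mul_assoc)
  then show "tilde_shift (P_mat \<tau>) n m ** transpose Y - P_mat \<tau> n m ** transpose Y
             + hat_shift (Q_mat \<tau>) n m ** transpose Y - Q_mat \<tau> n m ** transpose Y = 0"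
    by (simp add: matrix_add_rdistrib matrix_diff_rdistrib)
qed

end
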